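(* There is a (deterministic) protocol for message exchange in the speaker termination model that is resilient to a noise rate of $\frac{9-\sqrt{57}}{4}\approx 0.3625$ relative to the round of the last sent message.
   Context: Message exchange: Alice holds $x\in\{0,1\}^n$, Bob holds $y\in\{0,1\}^n$, and the goal is that both parties output $(x,y)$. Speaker termination model: the protocol proceeds in rounds; in each round a single party, fixed beforehand (independently of inputs and of what is received), sends one symbol of an alphabet $\Sigma$ (large but of constant size) to the other party. At any round a party may irreversibly terminate, outputting a guess; after that it neither speaks nor listens, and in rounds where a terminated party would be the speaker nothing (a silence symbol) is transmitted. An adversary may corrupt any transmitted symbol (including silence) into any other symbol. The protocol is resilient to an $\alpha$ fraction of errors if for all inputs $x,y$ and every adversarial attack in which the last round in which some party speaks is round $R$, if the number of corrupted rounds is at most $\alpha R$ then both Alice and Bob output $(x,y)$. *)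

theory Defs
  imports Complex_Main
begin

datatype party = Alice | Bob

text \<open>
  A deterministic protocol in the speaker termination model. Rounds are \<open>0, ..., rounds P - 1\<close>;
  the symbols of the alphabet of size \<open>q\<close> are the numbers below \<open>q\<close>, and a channel signal is a
  \<open>nat option\<close>, where \<open>None\<close> is silence. The arguments of \<open>send\<close>, \<open>stops\<close> and \<open>guess\<close> are the
  party, its private input, the current time \<open>t\<close> (rounds \<open>0, ..., t - 1\<close> have taken place), and
  the signals which that party received in those of the first \<open>t\<close> rounds in which it was the
  listener. \<open>stops\<close> says whether the party terminates at time \<open>t\<close>, that is, before acting in
  round \<open>t\<close>.
\<close>

record protocol =
  rounds :: nat
  speaker :: "nat \<Rightarrow> party"
  send :: "party \<Rightarrow> bool list \<Rightarrow> nat \<Rightarrow> nat option list \<Rightarrow> nat"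
  stops :: "party \<Rightarrow> bool list \<Rightarrow> nat \<Rightarrow> nat option list \<Rightarrow> bool"
  guess :: "party \<Rightarrow> bool list \<Rightarrow> nat \<Rightarrow> nat option list \<Rightarrow> bool list \<times> bool list"

definition over_alphabet :: "nat \<Rightarrow> protocol \<Rightarrow> bool" where
  "over_alphabet q P \<longleftrightarrow> (\<forall>p z t h. send P p z t h < q)"

fun input_of :: "bool list \<Rightarrow> bool list \<Rightarrow> party \<Rightarrow> bool list" where
  "input_of x y Alice = x"
| "input_of x y Bob = y"

text \<open>
  The protocol being deterministic, an attack on a fixed pair of inputs is determined by the
  sequence \<open>r\<close> of signals delivered to the listeners, however adaptively the adversary chooses
  it. Any alphabet symbol or silence may be delivered in any round.
\<close>

definition attack :: "nat \<Rightarrow> protocol \<Rightarrow> (nat \<Rightarrow> nat option) \<Rightarrow> bool" where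
  "attack q P r \<longleftrightarrow> (\<forall>t < rounds P. r t = None \<or> (\<exists>s < q. r t = Some s))"

definition heard :: "protocol \<Rightarrow> (nat \<Rightarrow> nat option) \<Rightarrow> party \<Rightarrow> nat \<Rightarrow> nat option list" where
  "heard P r p t = map r (filter (\<lambda>i. speaker P i \<noteq> p) [0..<t])"

text \<open>A party that has not terminated earlier terminates when all rounds are over.\<close>

definition stop_time :: "protocol \<Rightarrow> (nat \<Rightarrow> nat option) \<Rightarrow> party \<Rightarrow> bool list \<Rightarrow> nat" where
  "stop_time P r p z = (LEAST t. t = rounds P \<or> stops P p z t (heard P r p t))"

definition result :: "protocol \<Rightarrow> (nat \<Rightarrow> nat option) \<Rightarrow> party \<Rightarrow> bool list \<Rightarrow> bool list \<times> bool list"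
  where "result P r p z = (let t = stop_time P r p z in guess P p z t (heard P r p t))"

definition sent :: "protocol \<Rightarrow> (nat \<Rightarrow> nat option) \<Rightarrow> bool list \<Rightarrow> bool list \<Rightarrow> nat \<Rightarrow> nat option"
  where
  "sent P r x y t =
     (let p = speaker P t; z = input_of x y p in
      if t < stop_time P r p z then Some (send P p z t (heard P r p t)) else None)"

definition corrupted :: "protocol \<Rightarrow> (nat \<Rightarrow> nat option) \<Rightarrow> bool list \<Rightarrow> bool list \<Rightarrow> nat set" where
  "corrupted P r x y = {t. t < rounds P \<and> r t \<noteq> sent P r x y t}"

text \<open>
  The last round in which a party speaks, where rounds are counted from 1 (round \<open>t\<close> above is the
  \<open>Suc t\<close>-th round); 0 if nobody ever speaks.
\<close>

definition last_spoken :: "protocol \<Rightarrow> (nat \<Rightarrow> nat option) \<Rightarrow> bool list \<Rightarrow> bool list \<Rightarrow> nat" where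
  "last_spoken P r x y = Max (insert 0 {Suc t | t. t < rounds P \<and> sent P r x y t \<noteq> None})"

definition message_exchange_resilient :: "nat \<Rightarrow> nat \<Rightarrow> real \<Rightarrow> protocol \<Rightarrow> bool" where
  "message_exchange_resilient q n \<alpha> P \<longleftrightarrow>
     (\<forall>x y r. length x = n \<longrightarrow> length y = n \<longrightarrow> attack q P r \<longrightarrow>
        real (card (corrupted P r x y)) \<le> \<alpha> * real (last_spoken P r x y) \<longrightarrow>
        result P r Alice x = (x, y) \<and> result P r Bob y = (x, y))"

end

theory Submission
  imports Defs "HOL-Library.Countable"
begin

text \<open>
  In units of \<open>N\<close> rounds, Alice first sends her input for 300 units, then Bob talks for 800 units,
  and the last 1100 units are reserved for Alice. If Alice's first message reached Bob with many
  errors, he terminates after 111 units: by then so little has been said that even the attack which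
  replaces half of that message exceeds the budget. Otherwise he keeps repeating his input and
  his estimate of Alice's. Alice normally terminates as soon as Bob's turn is over. Only if what
  she heard is within a distance \<open>k \<le> 195 N\<close> of a message in which Bob's estimate is wrong, she
  goes on to repeat her input for \<open>1100 N - 3 k\<close> rounds, while a silent Alice confirms the
  estimate. Letting her talk less when she heard more errors keeps the total length, and with it the
  budget for forging an alarm, small. With the \<open>k\<close> errors already spent, the shorter talk still
  suffices to tell Bob which input she has.

  All conflicts between two inputs that are consistent with the view of one party are refuted by
  adding up the corruptions the two explanations require, because distinct transmitted signals are
  almost disjoint. The inequalities hold with room to spare up to a noise rate of
  \<open>7251/20000 > (9 - sqrt 57)/4\<close>, which absorbs the agreement between codewords over a finite alphabet.
\<close>

subsection \<open>Codes from digit expansions\<close>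

text \<open>
  The \<open>i\<close>-th codeword is the sequence of \<open>i\<close>-th digits of \<open>0, 1, 2, ...\<close>. Two codewords agree in
  about every \<open>q\<close>-th place of every sufficiently long prefix, however many codewords there are.
\<close>

definition digit :: "nat \<Rightarrow> nat \<Rightarrow> nat \<Rightarrow> nat" where
  "digit q i t = t div q ^ i mod q"

lemma digit_mod_power:
  assumes "i < j"
  shows "digit q i (t mod q ^ j) = digit q i t"
proof -
  obtain d where d: "j = i + Suc d"
    using assms less_iff_Suc_add by auto
  have "t mod q ^ j = q ^ i * (t div q ^ i mod q ^ Suc d) + t mod q ^ i"
    unfolding d power_add by (rule mod_mult2_eq)
  then have "t mod q ^ j div q ^ i = t div q ^ i mod q ^ Suc d"
    by (cases "q ^ i = 0") (simp_all add: d)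
  then show ?thesis
    unfolding digit_def by (simp add: mod_mod_cancel)
qed

text \<open>Where the two digits agree, the digit at \<open>j\<close> can be read off
  \<open>t mod q ^ j\<close>, so \<open>t\<close> is recovered after deleting it. This leaves about
  a \<open>q\<close>-th part of all times.\<close>

lemma digits_agree_bound_less:
  assumes "i < j" "q > 0"
  shows "card {t. t < T \<and> digit q i t = digit q j t} \<le> T div q + q ^ j"
proof -
  let ?S = "{t. t < T \<and> digit q i t = digit q j t}"
  let ?f = "\<lambda>t. (t div q ^ Suc j, t mod q ^ j)"
  have split: "t = q ^ Suc j * (t div q ^ Suc j) + (q ^ j * digit q j t + t mod q ^ j)" for t
  proof -
    have "t mod q ^ Suc j = q ^ j * digit q j t + t mod q ^ j"
      unfolding digit_def power_Suc2 by (rule mod_mult2_eq)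
    then show ?thesis by (metis mult_div_mod_eq)
  qed
  have "inj_on ?f ?S"
  proof (rule inj_onI)
    fix t u assume t: "t \<in> ?S" and u: "u \<in> ?S" and eq: "?f t = ?f u"
    have "digit q j t = digit q i (t mod q ^ j)" "digit q j u = digit q i (u mod q ^ j)"
      using t u digit_mod_power[OF assms(1)] by auto
    then have "digit q j t = digit q j u" using eq by simp
    then show "t = u" using split[of t] split[of u] eq by simp
  qed
  moreover have "?f ` ?S \<subseteq> {..T div q ^ Suc j} \<times> {..<q ^ j}"
    using assms(2) by (auto intro!: div_le_mono)
  ultimately have "card ?S \<le> card ({..T div q ^ Suc j} \<times> {..<q ^ j})"
    by (intro card_inj_on_le) auto
  also have "\<dots> = T div q div q ^ j * q ^ j + q ^ j"
    by (simp add: div_mult2_eq algebra_simps)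
  also have "\<dots> \<le> T div q + q ^ j" by simp
  finally show ?thesis .
qed

lemma digits_agree_bound:
  assumes "i \<noteq> j" "i < M" "j < M" "q > 0"
  shows "card {t. t < T \<and> digit q i t = digit q j t} \<le> T div q + q ^ M"
proof -
  have *: "card {t. t < T \<and> digit q i t = digit q j t} \<le> T div q + q ^ M"
    if "i < j" "j < M" for i j
  proof -
    have "q ^ j \<le> q ^ M" using that assms(4) by (intro power_increasing) auto
    then show ?thesis using digits_agree_bound_less[OF that(1) assms(4), of T] by linarith
  qed
  show ?thesis
  proof (cases "i < j")
    case False
    then show ?thesis using *[of j i] assms by (simp add: eq_commute)
  qed (use * assms in auto)
qed

subsection \<open>Hamming distances\<close>

definition errs :: "nat option list \<Rightarrow> (nat \<Rightarrow> nat option) \<Rightarrow> nat" where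
  "errs h f = (\<Sum>i<length h. of_bool (h ! i \<noteq> f i))"

definition agree :: "(nat \<Rightarrow> nat option) \<Rightarrow> (nat \<Rightarrow> nat option) \<Rightarrow> nat \<Rightarrow> nat" where
  "agree f g T = (\<Sum>i<T. of_bool (f i = g i))"

lemma errs_add_agree: "length h \<le> errs h f + errs h g + agree f g (length h)"
proof -
  have "length h = (\<Sum>i<length h. 1)" by simp
  also have "\<dots> \<le> (\<Sum>i<length h. of_bool (h ! i \<noteq> f i) + of_bool (h ! i \<noteq> g i) + of_bool (f i = g i))"
    by (rule sum_mono) auto
  finally show ?thesis unfolding errs_def agree_def by (simp add: sum.distrib)
qed

text \<open>Where the three signals differ pairwise, a received symbol matches at most one of them
  and so causes two errors; coincidences are charged to the agreement counts.\<close>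

lemma errs_add_agree3:
  "2 * length h \<le> errs h f + errs h g + errs h k +
     (agree f g (length h) + agree f k (length h) + agree g k (length h))"
proof -
  have "2 * length h = (\<Sum>i<length h. 2)" by simp
  also have "\<dots> \<le> (\<Sum>i<length h. of_bool (h ! i \<noteq> f i) + of_bool (h ! i \<noteq> g i) + of_bool (h ! i \<noteq> k i) +
      (of_bool (f i = g i) + of_bool (f i = k i) + of_bool (g i = k i)))"
    by (rule sum_mono) auto
  finally show ?thesis unfolding errs_def agree_def by (simp add: sum.distrib)
qed

lemma errs_map_upt:
  "errs (map r [a..<b]) f = (\<Sum>t=a..<b. of_bool (r t \<noteq> f (t - a)))"
proof -
  have "errs (map r [a..<b]) f = (\<Sum>i<b - a. of_bool (r (a + i) \<noteq> f i))"
    unfolding errs_def by simp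
  also have "\<dots> = (\<Sum>t=a..<b. of_bool (r t \<noteq> f (t - a)))"
    by (rule sum.reindex_bij_witness[of _ "\<lambda>t. t - a" "\<lambda>i. a + i"]) auto
  finally show ?thesis .
qed

lemma upt_append: "a \<le> b \<Longrightarrow> b \<le> c \<Longrightarrow> [a..<c] = [a..<b] @ [b..<c]"
  using upt_add_eq_append[of a b "c - b"] by simp

subsection \<open>The protocol\<close>

context
  fixes n :: nat
begin

definition msgs :: "(bool list \<times> bool list option) set" where
  "msgs = {(z, e). length z = n \<and> (\<forall>w. e = Some w \<longrightarrow> length w = n)}"

definition num_codes :: nat where
  "num_codes = Suc (Max (to_nat ` msgs))"

text \<open>Half of \<open>N\<close> pays for agreement at rate 1/2200 over \<open>1100 * N\<close>
  places, the other half for the additive error \<open>2200 ^ num_codes\<close>. Only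
  \<open>N\<close> depends on \<open>n\<close>; the alphabet size stays 2200.\<close>

definition N :: nat where
  "N = 2 * 2200 ^ num_codes"

definition codeword :: "bool list \<times> bool list option \<Rightarrow> nat \<Rightarrow> nat" where
  "codeword m = digit 2200 (to_nat m)"

text \<open>Serves both of Alice's blocks, with places counted from the start of the block.\<close>

definition sigA :: "bool list \<Rightarrow> nat \<Rightarrow> nat \<Rightarrow> nat option" where
  "sigA x c i = (if i < c then Some (codeword (x, None) i) else None)"

definition sigB :: "bool list \<times> bool list option \<Rightarrow> nat \<Rightarrow> nat option" where
  "sigB m i = (if snd m = None \<and> 111 * N \<le> i then None else Some (codeword m i))"

definition best :: "nat option list \<Rightarrow> bool list" where
  "best h = (ARG_MIN (\<lambda>z. errs h (sigA z (300 * N))) z. length z = n)"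

definition est :: "nat option list \<Rightarrow> bool list option" where
  "est h = (if errs h (sigA (best h) (300 * N)) \<le> 95 * N then Some (best h) else None)"

definition alarm :: "bool list \<Rightarrow> nat option list \<Rightarrow> bool list \<times> bool list option \<Rightarrow> bool" where
  "alarm x h m \<longleftrightarrow> m \<in> msgs \<and> snd m \<noteq> None \<and> snd m \<noteq> Some x \<and> errs h (sigB m) \<le> 195 * N"

text \<open>The factor 3 exceeds 1 / \<beta>, so each further error counted in k lowers the budget
  by more than one corruption. As k \<le> 195 N, at least 515 N rounds of talk remain.\<close>

definition extra :: "bool list \<Rightarrow> nat option list \<Rightarrow> nat" where
  "extra x h = (if \<exists>m. alarm x h m then 1100 * N - 3 * errs h (sigB (Eps (alarm x h))) else 0)"

definition \<beta> :: real where
  "\<beta> = 7251 / 20000"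

text \<open>Alice stays silent for one of two reasons: Bob's estimate is right, or he had none,
  which means that at least 95 N errors hit her first message.\<close>

definition plausible_y :: "bool list \<Rightarrow> nat option list \<Rightarrow> bool list \<Rightarrow> bool" where
  "plausible_y x h y \<longleftrightarrow> length y = n \<and>
     (errs h (sigB (y, Some x)) \<le> \<beta> * (1100 * N) \<or> errs h (sigB (y, None)) + 95 * N \<le> \<beta> * (411 * N))"

text \<open>Bob's estimate is \<open>best h\<close>, so only another input makes Alice talk again.
  He cannot see the distance k that she measured, hence the quantifier; k also counts as corruption
  already spent.\<close>

definition plausible_x :: "nat option list \<Rightarrow> nat option list \<Rightarrow> bool list \<Rightarrow> bool" where
  "plausible_x h h' x \<longleftrightarrow> length x = n \<and>
     (if x = best h then errs h (sigA x (300 * N)) + errs h' (sigA x 0) \<le> \<beta> * (1100 * N)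
      else \<exists>k \<le> 195 * N. errs h (sigA x (300 * N)) + k + errs h' (sigA x (1100 * N - 3 * k))
             \<le> \<beta> * (2200 * N - 3 * real k))"

definition exchange :: protocol where
  "exchange = \<lparr>
     rounds = 2200 * N,
     speaker = (\<lambda>t. if 300 * N \<le> t \<and> t < 1100 * N then Bob else Alice),
     send = (\<lambda>p z t h. case p of
         Alice \<Rightarrow> codeword (z, None) (if t < 300 * N then t else t - 1100 * N)
       | Bob \<Rightarrow> codeword (z, est h) (t - 300 * N)),
     stops = (\<lambda>p z t h. case p of
         Alice \<Rightarrow> 1100 * N + extra z h \<le> t \<and> 1100 * N \<le> t
       | Bob \<Rightarrow> t = 411 * N \<and> est h = None),
     guess = (\<lambda>p z t h. case p of
         Alice \<Rightarrow> (z, if \<exists>m. alarm z h m then fst (Eps (alarm z h)) else Eps (plausible_y z h))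
       | Bob \<Rightarrow> (if t = 411 * N then best h
                 else Eps (plausible_x (take (300 * N) h) (drop (300 * N) h)), z)) \<rparr>"

section \<open>Agreement of transmitted signals\<close>

lemma N_pos: "N > 0"
  unfolding N_def by simp

lemma finite_msgs: "finite msgs"
proof -
  have L: "finite {w :: bool list. length w = n}"
    using finite_lists_length_eq[of "UNIV :: bool set" n] by simp
  have "msgs \<subseteq> {w. length w = n} \<times> insert None (Some ` {w. length w = n})"
  proof
    fix m assume "m \<in> msgs"
    then show "m \<in> {w. length w = n} \<times> insert None (Some ` {w. length w = n})"
      by (cases m; cases "snd m") (simp_all add: msgs_def)
  qed
  then show ?thesis
    by (rule finite_subset) (use L in auto)
qed

lemma codeword_agree:
  assumes "m \<in> msgs" "m' \<in> msgs" "m \<noteq> m'" "T \<le> 1100 * N"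
  shows "card {t. t < T \<and> codeword m t = codeword m' t} \<le> N"
proof -
  have "to_nat m < num_codes" if "m \<in> msgs" for m
    using that finite_msgs unfolding num_codes_def by (auto simp: less_Suc_eq_le)
  then have "card {t. t < T \<and> codeword m t = codeword m' t} \<le> T div 2200 + 2200 ^ num_codes"
    unfolding codeword_def using assms by (intro digits_agree_bound) auto
  also have "T div 2200 \<le> 1100 * N div 2200"
    using assms(4) by (rule div_le_mono)
  finally show ?thesis unfolding N_def by simp
qed

text \<open>Silence differs from every symbol, so before \<open>T'\<close> signals coincide only
  where codewords do. All later places, where both may be silent, are counted as agreement.\<close>

lemma agree_le:
  assumes "m \<in> msgs" "m' \<in> msgs" "m \<noteq> m'" "T' \<le> T" "T' \<le> 1100 * N"
    and "\<And>i. i < T \<Longrightarrow> f i = g i \<Longrightarrow> T' \<le> i \<or> codeword m i = codeword m' i"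
  shows "agree f g T \<le> N + (T - T')"
proof -
  have "agree f g T = card {i. i < T \<and> f i = g i}"
    unfolding agree_def by (simp add: sum.inter_filter[symmetric] of_bool_def card_eq_sum[symmetric] Int_def lessThan_def)
  also have "\<dots> \<le> card ({i. i < T' \<and> codeword m i = codeword m' i} \<union> {T'..<T})"
    using assms(6) by (intro card_mono) fastforce+
  also have "\<dots> \<le> card {i. i < T' \<and> codeword m i = codeword m' i} + (T - T')"
    using card_Un_le[of _ "{T'..<T}"] by simp
  also have "\<dots> \<le> N + (T - T')"
    using codeword_agree[OF assms(1-3,5)] by simp
  finally show ?thesis .
qed

lemma agree_sigA:
  assumes "length x = n" "length x' = n" "x \<noteq> x'" "c \<le> T" "c' \<le> T" "T \<le> 1100 * N"
  shows "agree (sigA x c) (sigA x' c') T \<le> N + (T - max c c')"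
proof (rule agree_le[of "(x, None)" "(x', None)"])
  fix i assume "sigA x c i = sigA x' c' i"
  then show "max c c' \<le> i \<or> codeword (x, None) i = codeword (x', None) i"
    unfolding sigA_def by (cases "i < c"; cases "i < c'") simp_all
qed (use assms in \<open>simp_all add: msgs_def\<close>)

lemma agree_sigB:
  assumes "m \<in> msgs" "m' \<in> msgs" "m \<noteq> m'" "snd m \<noteq> None"
  shows "agree (sigB m) (sigB m') (800 * N) \<le> N"
proof -
  have "codeword m i = codeword m' i" if "sigB m i = sigB m' i" for i
    using that assms(4) unfolding sigB_def by (simp split: if_splits)
  then show ?thesis
    using agree_le[OF assms(1-3), of "800 * N" "800 * N" "sigB m" "sigB m'"] by simp
qed

lemma agree_sigB_None:
  assumes "length y = n" "length y' = n" "y \<noteq> y'"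
  shows "agree (sigB (y, None)) (sigB (y', None)) (800 * N) \<le> 690 * N"
proof -
  have "111 * N \<le> i \<or> codeword (y, None) i = codeword (y', None) i"
    if "sigB (y, None) i = sigB (y', None) i" for i
    using that unfolding sigB_def by (simp split: if_splits)
  moreover have "(y, None) \<in> msgs" "(y', None) \<in> msgs" using assms unfolding msgs_def by auto
  ultimately show ?thesis
    using agree_le[of "(y, None)" "(y', None)" "111 * N" "800 * N" "sigB (y, None)" "sigB (y', None)"]
      assms(3) by simp
qed

section \<open>Nearest inputs and uniqueness of explanations\<close>

lemma
  shows length_best: "length (best h) = n"
    and errs_best: "length x = n \<Longrightarrow> errs h (sigA (best h) (300 * N)) \<le> errs h (sigA x (300 * N))"
proof -
  have "length (replicate n True) = n" by simp
  then show "length (best h) = n"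
    unfolding best_def by (rule arg_min_natI)
  show "length x = n \<Longrightarrow> errs h (sigA (best h) (300 * N)) \<le> errs h (sigA x (300 * N))"
    unfolding best_def by (rule arg_min_nat_le)
qed

lemma errs_sigA:
  assumes "length h = 300 * N" "length x = n" "length x' = n" "x \<noteq> x'"
  shows "299 * N \<le> errs h (sigA x (300 * N)) + errs h (sigA x' (300 * N))"
  using errs_add_agree[of h "sigA x (300 * N)" "sigA x' (300 * N)"]
    agree_sigA[OF assms(2-4), of "300 * N" "300 * N" "300 * N"] assms(1) by simp

text \<open>Two explanations would need too many errors in Bob's block: 2 * 1100 \<beta> < 799 if
  both have an estimate, 2 * (411 \<beta> - 95) < 110 if neither has, with ample room in the mixed
  case.\<close>

lemma plausible_y_unique:
  assumes "plausible_y x h y" "plausible_y x h y'" "length h = 800 * N" "length x = n"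
  shows "y = y'"
proof (rule ccontr)
  assume ne: "y \<noteq> y'"
  have len: "length y = n" "length y' = n" using assms unfolding plausible_y_def by auto
  have a: "agree (sigB (y, Some x)) (sigB (y', e)) (800 * N) \<le> N" if "e \<in> {None, Some x}" for e
    by (rule agree_sigB) (use that ne len assms(4) in \<open>auto simp: msgs_def\<close>)
  have a': "agree (sigB (y', Some x)) (sigB (y, e)) (800 * N) \<le> N" if "e \<in> {None, Some x}" for e
    by (rule agree_sigB) (use that ne len assms(4) in \<open>auto simp: msgs_def\<close>)
  note d = errs_add_agree[of h "sigB (y, Some x)" "sigB (y', Some x)"]
    errs_add_agree[of h "sigB (y, Some x)" "sigB (y', None)"]
    errs_add_agree[of h "sigB (y', Some x)" "sigB (y, None)"]
    errs_add_agree[of h "sigB (y, None)" "sigB (y', None)"]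
  have "799 * N \<le> errs h (sigB (y, Some x)) + errs h (sigB (y', Some x))"
    "799 * N \<le> errs h (sigB (y, Some x)) + errs h (sigB (y', None))"
    "799 * N \<le> errs h (sigB (y', Some x)) + errs h (sigB (y, None))"
    "110 * N \<le> errs h (sigB (y, None)) + errs h (sigB (y', None))"
    using d a[of None] a[of "Some x"] a'[of None] agree_sigB_None[OF len ne] assms(3) by auto
  then have "799 * real N \<le> errs h (sigB (y, Some x)) + errs h (sigB (y', Some x))"
    "799 * real N \<le> errs h (sigB (y, Some x)) + errs h (sigB (y', None))"
    "799 * real N \<le> errs h (sigB (y', Some x)) + errs h (sigB (y, None))"
    "110 * real N \<le> errs h (sigB (y, None)) + errs h (sigB (y', None))"
    by linarith+
  moreover have "real N > 0" using N_pos by simp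
  ultimately show False using assms(1,2) unfolding plausible_y_def \<beta>_def by auto
qed

text \<open>Of two distinct candidates at least one is not \<open>best h\<close>; naming it
  \<open>x\<close> removes the symmetry.\<close>

lemma plausible_x_unique_aux:
  assumes px: "plausible_x h h' x" "plausible_x h h' x'"
    and h: "length h = 300 * N" "length h' = 1100 * N" "est h \<noteq> None"
    and ne: "x \<noteq> x'" "x \<noteq> best h"
  shows False
proof -
  let ?e = "\<lambda>x. errs h (sigA x (300 * N))"
  have len: "length x = n" "length x' = n" using px unfolding plausible_x_def by auto
  obtain k where k: "k \<le> 195 * N"
    "?e x + k + errs h' (sigA x (1100 * N - 3 * k)) \<le> \<beta> * (2200 * N - 3 * real k)"
    using px(1) ne(2) unfolding plausible_x_def by auto
  have A2: "max c c' \<le> errs h' (sigA x c) + errs h' (sigA x' c') + N"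
    if "c \<le> 1100 * N" "c' \<le> 1100 * N" for c c'
    using errs_add_agree[of h' "sigA x c" "sigA x' c'"] h(2) that
      agree_sigA[OF len ne(1) that order_refl] by auto
  have N: "real N > 0" using N_pos by simp
  show False
  proof (cases "x' = best h")
    case True
    then have "?e x' + errs h' (sigA x' 0) \<le> \<beta> * (1100 * N)"
      using px(2) unfolding plausible_x_def by simp
    moreover have "299 * N \<le> ?e x + ?e x'"
      using errs_sigA[OF h(1) len ne(1)] .
    then have "299 * real N \<le> ?e x + ?e x'" by linarith
    moreover have "1100 * real N - 3 * k \<le> errs h' (sigA x (1100 * N - 3 * k)) + errs h' (sigA x' 0) + real N"
      using A2[of "1100 * N - 3 * k" 0] k(1) by linarith
    \<comment> \<open>The joint cost is at least 1398 N - 2 k, against a budget of \<beta> (3300 N -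
      3 k). The tightest case is k = 195 N.\<close>
    ultimately show False using k N unfolding \<beta>_def by auto
  next
    case False
    then obtain k' where k': "k' \<le> 195 * N"
      "?e x' + k' + errs h' (sigA x' (1100 * N - 3 * k')) \<le> \<beta> * (2200 * N - 3 * real k')"
      using px(2) unfolding plausible_x_def by auto
    have b: "?e (best h) \<le> 95 * N"
      using h(3) unfolding est_def by (auto split: if_splits)
    have ag: "agree (sigA u (300 * N)) (sigA v (300 * N)) (300 * N) \<le> N"
      if "length u = n" "length v = n" "u \<noteq> v" for u v
      using agree_sigA[OF that, of "300 * N" "300 * N" "300 * N"] by simp
    \<comment> \<open>Three inputs compete for the first block. As \<open>best h\<close> accounts
      for at most 95 N errors, the other two share at least 502 N.\<close>
    have "600 * N \<le> ?e (best h) + ?e x + ?e x' + 3 * N"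
      using errs_add_agree3[of h "sigA (best h) (300 * N)" "sigA x (300 * N)" "sigA x' (300 * N)"]
        ag[of "best h" x] ag[of "best h" x'] ag[of x x'] len length_best ne False h(1) by simp
    then have "502 * real N \<le> ?e x + ?e x'" using b by linarith
    moreover have "max (1100 * real N - 3 * k) (1100 * real N - 3 * k')
        \<le> errs h' (sigA x (1100 * N - 3 * k)) + errs h' (sigA x' (1100 * N - 3 * k')) + real N"
      using A2[of "1100 * N - 3 * k" "1100 * N - 3 * k'"] k(1) k'(1) by linarith
    \<comment> \<open>Tightest at k = k' = 0, where the cost 1601 N still exceeds 4400 \<beta>
      N.\<close>
    ultimately show False using k k' N unfolding \<beta>_def by auto
  qed
qed

lemma plausible_x_unique:
  assumes "plausible_x h h' x" "plausible_x h h' x'"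
    and "length h = 300 * N" "length h' = 1100 * N" "est h \<noteq> None"
  shows "x = x'"
  using plausible_x_unique_aux[OF assms(1,2)] plausible_x_unique_aux[OF assms(2,1)] assms(3-5) by metis

subsection \<open>Runs of the protocol\<close>

lemma heard_Alice:
  assumes "1100 * N \<le> t"
  shows "heard exchange r Alice t = map r [300 * N..<1100 * N]"
proof -
  have "[0..<t] = [0..<300 * N] @ [300 * N..<1100 * N] @ [1100 * N..<t]"
    using assms upt_append[of 0 "300 * N" t] upt_append[of "300 * N" "1100 * N" t] by simp
  then show ?thesis
    unfolding heard_def exchange_def by (auto simp: filter_id_conv filter_empty_conv)
qed

lemma heard_Bob:
  assumes "300 * N \<le> t" "t \<le> 1100 * N"
  shows "heard exchange r Bob t = map r [0..<300 * N]"
proof -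
  have "[0..<t] = [0..<300 * N] @ [300 * N..<t]"
    using assms by (intro upt_append) auto
  then show ?thesis
    using assms unfolding heard_def exchange_def by (auto simp: filter_id_conv filter_empty_conv)
qed

lemma heard_Bob_end:
  "heard exchange r Bob (2200 * N) = map r [0..<300 * N] @ map r [1100 * N..<2200 * N]"
proof -
  have "[0..<2200 * N] = [0..<300 * N] @ [300 * N..<1100 * N] @ [1100 * N..<2200 * N]"
    using upt_append[of 0 "300 * N" "2200 * N"] upt_append[of "300 * N" "1100 * N" "2200 * N"] by simp
  then show ?thesis
    unfolding heard_def exchange_def by (auto simp: filter_id_conv filter_empty_conv)
qed

lemma extra_le: "extra x h \<le> 1100 * N"
  unfolding extra_def by simp

lemma stop_Alice:
  "stop_time exchange r Alice x = 1100 * N + extra x (map r [300 * N..<1100 * N])"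
  unfolding stop_time_def
proof (rule Least_equality)
  show "1100 * N + extra x (map r [300 * N..<1100 * N]) = rounds exchange \<or>
    stops exchange Alice x (1100 * N + extra x (map r [300 * N..<1100 * N]))
      (heard exchange r Alice (1100 * N + extra x (map r [300 * N..<1100 * N])))"
    by (simp add: heard_Alice) (simp add: exchange_def)
next
  fix t assume t: "t = rounds exchange \<or> stops exchange Alice x t (heard exchange r Alice t)"
  then have "1100 * N \<le> t" by (auto simp: exchange_def)
  then show "1100 * N + extra x (map r [300 * N..<1100 * N]) \<le> t"
    using t extra_le[of x] by (auto simp: heard_Alice) (auto simp: exchange_def)
qed

lemma stop_Bob:
  "stop_time exchange r Bob y = (if est (map r [0..<300 * N]) = None then 411 * N else 2200 * N)"
  unfolding stop_time_def
proof (rule Least_equality)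
  have h: "heard exchange r Bob (411 * N) = map r [0..<300 * N]" by (rule heard_Bob) auto
  show "(if est (map r [0..<300 * N]) = None then 411 * N else 2200 * N) = rounds exchange \<or>
    stops exchange Bob y (if est (map r [0..<300 * N]) = None then 411 * N else 2200 * N)
      (heard exchange r Bob (if est (map r [0..<300 * N]) = None then 411 * N else 2200 * N))"
    using h by (simp add: exchange_def)
  fix t assume "t = rounds exchange \<or> stops exchange Bob y t (heard exchange r Bob t)"
  then show "(if est (map r [0..<300 * N]) = None then 411 * N else 2200 * N) \<le> t"
    using h by (auto simp: exchange_def)
qed

section \<open>Signals sent and the cost of an attack\<close>

context
  fixes x y :: "bool list" and r :: "nat \<Rightarrow> nat option"
    and h1 hB h2 :: "nat option list"
  defines "h1 \<equiv> map r [0..<300 * N]"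
    and "hB \<equiv> map r [300 * N..<1100 * N]"
    and "h2 \<equiv> map r [1100 * N..<2200 * N]"
begin

lemma sent_A1: "t < 300 * N \<Longrightarrow> sent exchange r x y t = sigA x (300 * N) t"
  using stop_Alice[of r x] by (simp add: sent_def sigA_def exchange_def)

lemma sent_B:
  assumes "300 * N \<le> t" "t < 1100 * N"
  shows "sent exchange r x y t = sigB (y, est h1) (t - 300 * N)"
proof -
  have sp: "speaker exchange t = Bob" using assms by (simp add: exchange_def)
  have "send exchange Bob y t h1 = codeword (y, est h1) (t - 300 * N)"
    by (simp add: exchange_def)
  then show ?thesis
    using assms sp heard_Bob[of t r] stop_Bob[of r y] unfolding h1_def
    by (auto simp: sent_def sigB_def)
qed

lemma sent_A2:
  assumes "1100 * N \<le> t"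
  shows "sent exchange r x y t = sigA x (extra x hB) (t - 1100 * N)"
  using assms stop_Alice[of r x] unfolding hB_def
  by (auto simp: sent_def sigA_def) (auto simp: exchange_def)

lemma card_corrupted:
  "card (corrupted exchange r x y) =
     errs h1 (sigA x (300 * N)) + errs hB (sigB (y, est h1)) + errs h2 (sigA x (extra x hB))"
proof -
  let ?f = "\<lambda>t. of_bool (r t \<noteq> sent exchange r x y t) :: nat"
  have "card (corrupted exchange r x y) = sum ?f {0..<2200 * N}"
    unfolding corrupted_def
    by (simp add: exchange_def of_bool_def sum.inter_filter[symmetric] Int_def)
  also have "\<dots> = sum ?f {0..<300 * N} + sum ?f {300 * N..<1100 * N} + sum ?f {1100 * N..<2200 * N}"
    using sum.atLeastLessThan_concat[of 0 "300 * N" "2200 * N" ?f]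
      sum.atLeastLessThan_concat[of "300 * N" "1100 * N" "2200 * N" ?f]
    by (simp del: sum_of_bool_eq)
  also have "sum ?f {0..<300 * N} = errs h1 (sigA x (300 * N))"
    unfolding h1_def errs_map_upt by (intro sum.cong) (auto simp: sent_A1)
  also have "sum ?f {300 * N..<1100 * N} = errs hB (sigB (y, est h1))"
    unfolding hB_def errs_map_upt by (intro sum.cong) (auto simp: sent_B)
  also have "sum ?f {1100 * N..<2200 * N} = errs h2 (sigA x (extra x hB))"
    unfolding h2_def errs_map_upt by (intro sum.cong) (auto simp: sent_A2)
  finally show ?thesis .
qed

lemma last_spoken_le:
  "last_spoken exchange r x y \<le>
    (if extra x hB > 0 then 1100 * N + extra x hB else if est h1 = None then 411 * N else 1100 * N)"
  (is "_ \<le> ?L")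
proof -
  have "Suc t \<le> ?L" if "sent exchange r x y t \<noteq> None" for t
  proof -
    consider "t < 300 * N" | "300 * N \<le> t" "t < 1100 * N" | "1100 * N \<le> t" by linarith
    then show ?thesis
    proof cases
      case 2
      then show ?thesis using that sent_B[of t] by (auto simp: sigB_def split: if_splits)
    next
      case 3
      then show ?thesis using that sent_A2[of t] by (auto simp: sigA_def split: if_splits)
    qed auto
  qed
  then show ?thesis unfolding last_spoken_def by (intro Max.boundedI) auto
qed

section \<open>Correctness of both outputs within the error budget\<close>

context
  assumes len: "length x = n" "length y = n"
    and few: "real (card (corrupted exchange r x y)) \<le> \<beta> * real (last_spoken exchange r x y)"
begin

lemma est_Some: "est h1 = Some w \<Longrightarrow> w = best h1 \<and> errs h1 (sigA (best h1) (300 * N)) \<le> 95 * N"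
  unfolding est_def by (auto split: if_splits)

lemma true_msg: "(y, est h1) \<in> msgs"
  using len length_best unfolding msgs_def est_def by auto

lemma cost_bound:
  "real (errs h1 (sigA x (300 * N)) + errs hB (sigB (y, est h1)) + errs h2 (sigA x (extra x hB))) \<le>
   \<beta> * (if extra x hB > 0 then 1100 * N + extra x hB else if est h1 = None then 411 * N else 1100 * N)"
proof -
  have "\<beta> * real (last_spoken exchange r x y) \<le>
     \<beta> * (if extra x hB > 0 then 1100 * N + extra x hB else if est h1 = None then 411 * N else 1100 * N)"
    using last_spoken_le by (intro mult_left_mono of_nat_mono) (auto simp: \<beta>_def)
  then show ?thesis using few unfolding card_corrupted by linarith
qed

text \<open>A forged message at distance k forces 799 N - k corruptions in Bob's block, more than
  \<beta> (2200 N - 3 k) because 2200 \<beta> < 799 and 3 \<beta> > 1.\<close>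

lemma alarm_correct:
  assumes "alarm x hB m"
  shows "Eps (alarm x hB) = (y, est h1)"
proof (rule ccontr)
  define m' where "m' = Eps (alarm x hB)"
  define k where "k = errs hB (sigB m')"
  assume "Eps (alarm x hB) \<noteq> (y, est h1)"
  then have ne: "m' \<noteq> (y, est h1)" unfolding m'_def .
  have al: "alarm x hB m'" unfolding m'_def using assms by (rule someI)
  then have m': "m' \<in> msgs" "snd m' \<noteq> None" "k \<le> 195 * N"
    unfolding alarm_def k_def by auto
  have ex: "extra x hB = 1100 * N - 3 * k"
    unfolding extra_def k_def m'_def using assms by (simp only: if_P exI[of "alarm x hB" m])
  have "agree (sigB m') (sigB (y, est h1)) (800 * N) \<le> N"
    by (rule agree_sigB[OF m'(1) true_msg ne m'(2)])
  then have "799 * N \<le> k + errs hB (sigB (y, est h1))"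
    using errs_add_agree[of hB "sigB m'" "sigB (y, est h1)"] unfolding k_def hB_def by simp
  then have "799 * real N \<le> k + real (errs hB (sigB (y, est h1)))" by linarith
  moreover have "extra x hB > 0" using ex m'(3) N_pos by simp
  then have "real (errs hB (sigB (y, est h1))) \<le> \<beta> * real (1100 * N + extra x hB)"
    using cost_bound by simp
  moreover have "real (1100 * N + extra x hB) = 2200 * real N - 3 * k"
    unfolding ex using m'(3) by linarith
  ultimately show False using m'(3) N_pos unfolding \<beta>_def by simp
qed

lemma alarm_true:
  assumes "alarm x hB m"
  shows "alarm x hB (y, est h1)"
  using someI[of "alarm x hB", OF assms] unfolding alarm_correct[OF assms] .

text \<open>This lets Bob trust her silence: the true message itself satisfies the alarm condition,
  so no attack within the budget makes Alice contradict a correct estimate.\<close>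

lemma alarm_est: "alarm x hB m \<Longrightarrow> est h1 \<noteq> None \<and> est h1 \<noteq> Some x"
  using alarm_true unfolding alarm_def by fastforce

text \<open>A wrong estimate costs 204 N errors in the first block, and suppressing the alarm costs
  more than 195 N in Bob's; 399 exceeds 1100 \<beta>.\<close>

lemma est_correct:
  assumes "\<nexists>m. alarm x hB m" "est h1 \<noteq> None"
  shows "est h1 = Some x"
proof (rule ccontr)
  assume ne: "est h1 \<noteq> Some x"
  obtain w where w: "est h1 = Some w" using assms(2) by auto
  have b: "w = best h1" "errs h1 (sigA (best h1) (300 * N)) \<le> 95 * N" using est_Some[OF w] by auto
  have "195 * N < errs hB (sigB (y, est h1))"
    using assms(1) true_msg ne w unfolding alarm_def by (metis not_le option.discI snd_conv)
  moreover have "299 * N \<le> errs h1 (sigA x (300 * N)) + errs h1 (sigA (best h1) (300 * N))"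
    using w b ne by (intro errs_sigA) (auto simp: h1_def len length_best)
  ultimately have "399 * real N \<le> real (errs h1 (sigA x (300 * N)) + errs hB (sigB (y, est h1)))"
    using b by linarith
  moreover have "extra x hB = 0" using assms(1) unfolding extra_def by simp
  ultimately show False
    using cost_bound w N_pos unfolding \<beta>_def by simp
qed

lemma Alice_correct: "result exchange r Alice x = (x, y)"
proof -
  have "result exchange r Alice x = 
     (x, if \<exists>m. alarm x hB m then fst (Eps (alarm x hB)) else Eps (plausible_y x hB))"
    unfolding result_def Let_def stop_Alice hB_def
    by (simp add: heard_Alice) (simp add: exchange_def)
  moreover have "Eps (plausible_y x hB) = y" if no: "\<nexists>m. alarm x hB m"
  proof -
    have e0: "extra x hB = 0" using no unfolding extra_def by simp
    have "plausible_y x hB y"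
    proof (cases "est h1")
      case None
      then have "95 * N < errs h1 (sigA (best h1) (300 * N))" 
        unfolding est_def by (auto split: if_splits)
      \<comment> \<open>The nearest input is already too far away, so \<open>x\<close> is as well;
        this supplies the 95 N in \<open>plausible_y\<close>.\<close>
      then have "95 * N \<le> errs h1 (sigA x (300 * N))" using errs_best[OF len(1), of h1] by simp
      then show ?thesis using cost_bound e0 None len unfolding plausible_y_def by simp
    next
      case (Some w)
      then have "est h1 = Some x" using est_correct no by simp
      then show ?thesis using cost_bound e0 len unfolding plausible_y_def by simp
    qed
    moreover have "z = y" if "plausible_y x hB z" for z
      using plausible_y_unique[OF that calculation] len by (simp add: hB_def)
    ultimately show ?thesis by (rule some_equality)
  qed
  ultimately show ?thesis using alarm_correct by auto
qed

lemma Bob_correct: "result exchange r Bob y = (x, y)"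
proof (cases "est h1")
  case None
  have "\<nexists>m. alarm x hB m"
    using alarm_est None by blast
  then have e0: "extra x hB = 0" unfolding extra_def by simp
  have "best h1 = x"
  proof (rule ccontr)
    assume "best h1 \<noteq> x"
    then have "299 * N \<le> errs h1 (sigA x (300 * N)) + errs h1 (sigA (best h1) (300 * N))"
      by (intro errs_sigA) (auto simp: h1_def len length_best)
    \<comment> \<open>A wrong nearest input is at least as close as \<open>x\<close>, so
      \<open>x\<close> bears half of 299 N. Bob's early stop keeps 411 \<beta> below 149.5.\<close>
    then have "299 * real N \<le> 2 * real (errs h1 (sigA x (300 * N)))"
      using errs_best[OF len(1), of h1] by linarith
    then show False using cost_bound e0 None N_pos unfolding \<beta>_def by simp
  qed
  then show ?thesis
    using None heard_Bob[of "411 * N" r] unfolding result_def Let_def stop_Bob h1_def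
    by (simp add: exchange_def)
next
  case (Some w)
  have "plausible_x h1 h2 x"
  proof (cases "x = best h1")
    case True
    then have "\<nexists>m. alarm x hB m"
      using alarm_est Some est_Some[OF Some] by blast
    then have "extra x hB = 0" unfolding extra_def by simp
    then show ?thesis using cost_bound True Some len unfolding plausible_x_def by simp
  next
    case False
    \<comment> \<open>The witness for \<open>plausible_x\<close>: by \<open>alarm_correct\<close>,
      Alice measured her distance to Bob's true message, so k is also the actual corruption of his
      block.\<close>
    define k where "k = errs hB (sigB (y, est h1))"
    obtain m where m: "alarm x hB m" using est_correct Some est_Some[OF Some] False by auto
    have al: "alarm x hB (y, est h1)" using alarm_true[OF m] .
    then have ex: "extra x hB = 1100 * N - 3 * k"
      unfolding extra_def k_def alarm_correct[OF m] by (simp only: if_P exI[of "alarm x hB"])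
    have k: "k \<le> 195 * N" using al unfolding alarm_def k_def by auto
    then have "extra x hB > 0" "real (1100 * N + extra x hB) = 2200 * real N - 3 * k"
      using ex N_pos by linarith+
    then have "errs h1 (sigA x (300 * N)) + k + errs h2 (sigA x (1100 * N - 3 * k))
             \<le> \<beta> * (2200 * N - 3 * real k)"
      using cost_bound ex unfolding k_def by simp
    then show ?thesis using k False len unfolding plausible_x_def by auto
  qed
  moreover have "z = x" if "plausible_x h1 h2 z" for z
    using plausible_x_unique[OF that calculation] Some by (simp add: h1_def h2_def)
  ultimately have "Eps (plausible_x h1 h2) = x" by (rule some_equality)
  then show ?thesis
    using Some heard_Bob_end[of r] N_pos unfolding result_def Let_def stop_Bob h1_def h2_def
    by (simp add: exchange_def)
qed

end

end

lemma over_alphabet_exchange: "over_alphabet 2200 exchange"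
  unfolding over_alphabet_def exchange_def codeword_def digit_def by (simp split: party.split)

lemma exchange_resilient: "message_exchange_resilient q n \<beta> exchange"
  unfolding message_exchange_resilient_def using Alice_correct Bob_correct by blast

end

section \<open>Passing to the stated noise rate\<close>

lemma message_exchange_resilient_mono:
  assumes "message_exchange_resilient q n \<alpha> P" "\<alpha>' \<le> \<alpha>"
  shows "message_exchange_resilient q n \<alpha>' P"
proof -
  have "c \<le> \<alpha> * real l" if "c \<le> \<alpha>' * real l" for c l
    using that mult_right_mono[OF assms(2), of "real l"] by simp
  then show ?thesis
    using assms(1) unfolding message_exchange_resilient_def by blast
qed

theorem theorem1p1:
  "\<exists>q :: nat. \<forall>n :: nat. \<exists>P :: protocol.
     over_alphabet q P \<and> message_exchange_resilient q n ((9 - sqrt 57) / 4) P"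
proof -
  \<comment> \<open>The number 7.5498 equals 9 - 4 \<beta>.\<close>
  have "7.5498 \<le> sqrt 57" by (rule real_le_rsqrt) (simp add: power2_eq_square)
  then have "(9 - sqrt 57) / 4 \<le> \<beta>" unfolding \<beta>_def by simp
  then show ?thesis
    using over_alphabet_exchange exchange_resilient message_exchange_resilient_mono by metis
qed

end
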